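(* If $r$ is a real number with $r\geqslant1$, then the function $g(x)=x^r$ on $\mathbb R_+$ satisfies the following condition: there exists $\alpha_0>0$ such that for every $\alpha\geqslant\alpha_0$ there exists $\beta\in\mathbb R_+$ such that for all $m$ and all non-zero natural numbers $y_1,\dots,y_m,z$ with $y_1+\cdots+y_m\leqslant z$ one has $\sum_{j=1}^m g(\alpha y_j)\leqslant g(\beta z)$. *)

theory Defs imports Complex_Main begin

end

theory Submission imports Defs begin

text \<open>For \<open>r \<ge> 1\<close> the power function is superadditive on the nonnegative reals: writing
  \<open>S\<close> for the sum of the \<open>x\<^sub>j\<close>, each term satisfies
  \<open>x\<^sub>j powr r = x\<^sub>j * x\<^sub>j powr (r - 1) \<le> x\<^sub>j * S powr (r - 1)\<close>.
  Hence \<open>\<beta> = \<alpha>\<close> works for every \<open>\<alpha> > 0\<close>.\<close>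

lemma sum_powr_le_powr_sum:
  fixes f :: "'a \<Rightarrow> real" and r :: real
  assumes "finite A" and nonneg: "\<And>i. i \<in> A \<Longrightarrow> f i \<ge> 0" and "r \<ge> 1"
  shows "(\<Sum>i\<in>A. f i powr r) \<le> (\<Sum>i\<in>A. f i) powr r"
proof -
  \<comment> \<open>The case x = 0 is included, since \<open>0 powr a = 0\<close> for every
    exponent.\<close>
  have split: "x powr r = x * x powr (r - 1)" if "x \<ge> 0" for x :: real
    using that by (simp add: powr_mult_base)
  have "(\<Sum>i\<in>A. f i powr r) \<le> (\<Sum>i\<in>A. f i * sum f A powr (r - 1))"
  proof (rule sum_mono)
    fix i assume i: "i \<in> A"
    have "f i \<le> sum f A"
      using member_le_sum[of i A f] i assms by auto
    \<comment> \<open>Monotonicity in the base requires r - 1 \<ge> 0; this is where r \<ge> 1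
      enters.\<close>
    then have "f i powr (r - 1) \<le> sum f A powr (r - 1)"
      using nonneg[OF i] \<open>r \<ge> 1\<close> by (intro powr_mono2) auto
    then show "f i powr r \<le> f i * sum f A powr (r - 1)"
      using nonneg[OF i] by (simp add: split mult_left_mono)
  qed
  also have "\<dots> = sum f A powr r"
    \<comment> \<open>The common factor leaves the sum, and \<open>split\<close> is read backwards
      at x = \<open>sum f A\<close>.\<close>
    using split[OF sum_nonneg[of A f]] nonneg by (simp add: sum_distrib_right)
  finally show ?thesis .
qed

theorem proposition5p1p10:
  fixes r :: real and g :: "real \<Rightarrow> real"
  assumes "r \<ge> 1"
    and "\<And>x. x \<ge> 0 \<Longrightarrow> g x = x powr r"
  shows "\<exists>\<alpha>\<^sub>0 :: real. \<alpha>\<^sub>0 > 0 \<and> (\<forall>\<alpha> :: real. \<alpha> \<ge> \<alpha>\<^sub>0 \<longrightarrow>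
           (\<exists>\<beta> :: real. \<beta> \<ge> 0 \<and>
             (\<forall>(m :: nat) (y :: nat \<Rightarrow> nat) (z :: nat).
                (\<forall>j\<in>{1..m}. y j \<noteq> 0) \<and> z \<noteq> 0 \<and> (\<Sum>j = 1..m. y j) \<le> z \<longrightarrow>
                (\<Sum>j = 1..m. g (\<alpha> * real (y j))) \<le> g (\<beta> * real z))))"
proof -
  have "(\<Sum>j = 1..m. g (\<alpha> * real (y j))) \<le> g (\<alpha> * real z)"
    if "\<alpha> \<ge> 1" and "(\<Sum>j = 1..m. y j) \<le> z"
    for \<alpha> :: real and m :: nat and y :: "nat \<Rightarrow> nat" and z :: nat
  proof -
    \<comment> \<open>\<open>g\<close> is prescribed only on nonnegative arguments; \<alpha> \<ge> 1
      keeps them there.\<close>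
    have "(\<Sum>j = 1..m. g (\<alpha> * real (y j))) = (\<Sum>j = 1..m. (\<alpha> * real (y j)) powr r)"
      using that assms(2) by simp
    also have "\<dots> \<le> (\<Sum>j = 1..m. \<alpha> * real (y j)) powr r"
      using that assms(1) by (intro sum_powr_le_powr_sum) auto
    also have "\<dots> = (\<alpha> * real (\<Sum>j = 1..m. y j)) powr r"
      by (simp add: sum_distrib_left)
    also have "\<dots> \<le> (\<alpha> * real z) powr r"
    proof (rule powr_mono2)
      show "\<alpha> * real (\<Sum>j = 1..m. y j) \<le> \<alpha> * real z"
        using that by (intro mult_left_mono of_nat_mono) auto
      show "0 \<le> \<alpha> * real (\<Sum>j = 1..m. y j)"
        using that by (intro mult_nonneg_nonneg of_nat_0_le_iff) auto
    qed (use assms(1) in simp)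
    also have "\<dots> = g (\<alpha> * real z)"
      using that assms(2) by simp
    finally show ?thesis .
  qed
  then show ?thesis
    \<comment> \<open>The witnesses are \<open>\<alpha>\<^sub>0 = 1\<close> and \<beta> = \<alpha>,
      with \<beta> \<ge> 0 from 0 \<le> 1 \<le> \<alpha>.\<close>
    by (metis zero_less_one zero_le_one order_trans)
qed

end
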